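(* Let $\mathcal{M}$ and $\mathcal{N}$ be smooth finite-dimensional manifolds without boundary and let $r\in\mathbb{N}\cup\{+\infty\}$. Let $B:\mathcal{M}\to Bar$ be $r$-differentiable at $x\in\mathcal{M}$, and let $V:Bar\to\mathcal{N}$ be $r$-differentiable at $B(x)$. Then: (i) $V\circ B:\mathcal{M}\to\mathcal{N}$ is $C^r$ at $x$ as a map between smooth manifolds; (ii) if $r\geq 1$, then for any local $C^1$ lift $\tilde B:U\to\mathbb{R}^{2m}\times\mathbb{R}^n$ of $B$ around $x$ we have \[ d_x(V\circ B)=d_{B(x),\tilde B(x)}V\circ d_{x,\tilde B}B. \]
   Context: Barcodes: a barcode is a multiset $D=D'\cup\Delta^\infty$, where $D'$ is a finite multiset of elements of $\mathbb{R}\times(\mathbb{R}\cup\{+\infty\})$ and $\Delta^\infty$ consists of the diagonal $\Delta=\{(b,b)\mid b\in\mathbb{R}\}$ with countably infinite multiplicity. $Bar$ is the set of barcodes. For $m,n\in\mathbb{N}$, the quotient map $Q_{m,n}:\mathbb{R}^{2m}\times\mathbb{R}^n\to Bar$ is $Q_{m,n}(b_1,d_1,\dots,b_m,d_m,v_1,\dots,v_n)=\{(b_i,d_i)\}_{i=1}^m\cup\{(v_j,+\infty)\}_{j=1}^n\cup\Delta^\infty$. A map $B:\mathcal{M}\to Bar$ is $r$-differentiable at $x$ if there are an open neighborhood $U$ of $x$, integers $m,n\in\mathbb{N}$ and a $C^r$ map $\tilde B:U\to\mathbb{R}^{2m}\times\mathbb{R}^n$ with $B=Q_{m,n}\circ\tilde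 B$ on $U$; such a $\tilde B$ is called a local ($C^r$) lift of $B$. If $\tilde B$ is a local $C^1$ lift around $x$, the differential of $B$ at $x$ with respect to $\tilde B$ is $d_{x,\tilde B}B:=d_x\tilde B:T_x\mathcal{M}\to\mathbb{R}^{2m}\times\mathbb{R}^n$. A map $V:Bar\to\mathcal{N}$ is $r$-differentiable at $D\in Bar$ if for all $m,n\in\mathbb{N}$ and all $\tilde D\in\mathbb{R}^{2m}\times\mathbb{R}^n$ with $Q_{m,n}(\tilde D)=D$, the map $V\circ Q_{m,n}$ is $C^r$ on an open neighborhood of $\tilde D$. For $r\ge1$ and such a $\tilde D$, the differential of $V$ at $D$ with respect to $\tilde D$ is $d_{D,\tilde D}V:=d_{\tilde D}(V\circ Q_{m,n}):\mathbb{R}^{2m+n}\to T_{V(D)}\mathcal{N}$. "$C^r$ at $x$" means $C^r$ on some open neighborhood of $x$. *)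

theory Defs
  imports "HOL-Analysis.Analysis" "HOL-Library.Multiset" "HOL-Library.Extended_Nat"
begin

section \<open>Maps of class C^r on open subsets of a finite-dimensional vector space\<close>

text \<open>
  All coordinate spaces are finite-dimensional linear subspaces \<open>E\<close> of a real normed vector space.
  Unlike an index type of class \<open>finite\<close>, this allows dimension 0 and allows the dimension to be
  quantified inside a formula.  Derivatives are the library's \<open>has_derivative\<close>, taken within the
  subspace; on vectors of \<open>E\<close> they are uniquely determined, and only those are ever used.
\<close>

definition finite_dim_subspace :: "'e::real_normed_vector set \<Rightarrow> bool" where
  "finite_dim_subspace E \<longleftrightarrow> (\<exists>S. finite S \<and> E = span S)"

text \<open>
  \<open>Ck_on E k W f\<close>: \<open>f\<close> is of class C^k on \<open>W\<close>, where \<open>W\<close> is a relatively open subset of \<open>E\<close>.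
  C^(k+1) means differentiable with \<open>x \<mapsto> Df(x) v\<close> of class C^k for each direction \<open>v \<in> E\<close>; as \<open>E\<close>
  has finite dimension, this is the same as \<open>Df\<close> being of class C^k.
\<close>

primrec Ck_on ::
  "'e::real_normed_vector set \<Rightarrow> nat \<Rightarrow> 'e set \<Rightarrow> ('e \<Rightarrow> 'f::real_normed_vector) \<Rightarrow> bool" where
  "Ck_on E 0 = (\<lambda>W f. continuous_on W f)"
| "Ck_on E (Suc k) = (\<lambda>W f. \<exists>D. (\<forall>x\<in>W. (f has_derivative D x) (at x within W)) \<and>
                                 (\<forall>v\<in>E. Ck_on E k W (\<lambda>x. D x v)))"

definition Cr_on ::
  "'e::real_normed_vector set \<Rightarrow> enat \<Rightarrow> 'e set \<Rightarrow> ('e \<Rightarrow> 'f::real_normed_vector) \<Rightarrow> bool" where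
  "Cr_on E r W f \<longleftrightarrow> (\<forall>k::nat. enat k \<le> r \<longrightarrow> Ck_on E k W f)"


section \<open>Smooth manifolds\<close>

text \<open>A chart \<open>(U, \<phi>)\<close> is a domain together with a map that is only relevant on \<open>U\<close>.\<close>

type_synonym ('a, 'e) chart = "'a set \<times> ('a \<Rightarrow> 'e)"

record ('a, 'e) mfd =
  Top :: "'a topology"
  Model :: "'e set"
  Atlas :: "('a, 'e) chart set"

abbreviation Points :: "('a, 'e) mfd \<Rightarrow> 'a set" where
  "Points M \<equiv> topspace (Top M)"

definition is_chart ::
  "'a topology \<Rightarrow> 'e::real_normed_vector set \<Rightarrow> ('a, 'e) chart \<Rightarrow> bool" where
  "is_chart X E c \<longleftrightarrow>
     openin X (fst c) \<and>
     openin (top_of_set E) (snd c ` fst c) \<and>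
     homeomorphic_map (subtopology X (fst c)) (top_of_set (snd c ` fst c)) (snd c)"

text \<open>The map \<open>f\<close> read in the charts \<open>c\<close> and \<open>d\<close>, that is \<open>\<psi> \<circ> f \<circ> \<phi>\<^sup>-\<^sup>1\<close>.\<close>

definition local_rep ::
  "('a, 'e) chart \<Rightarrow> ('b, 'f) chart \<Rightarrow> ('a \<Rightarrow> 'b) \<Rightarrow> 'e \<Rightarrow> 'f" where
  "local_rep c d f = snd d \<circ> f \<circ> inv_into (fst c) (snd c)"

text \<open>
  The atlas need not be maximal: the notions below do not change when it is replaced by the
  maximal atlas containing it.
\<close>

definition smooth_manifold :: "('a, 'e::real_normed_vector) mfd \<Rightarrow> bool" where
  "smooth_manifold M \<longleftrightarrow>
     finite_dim_subspace (Model M) \<and>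
     Hausdorff_space (Top M) \<and> second_countable (Top M) \<and>
     (\<forall>c\<in>Atlas M. is_chart (Top M) (Model M) c) \<and>
     (\<Union>c\<in>Atlas M. fst c) = Points M \<and>
     (\<forall>c\<in>Atlas M. \<forall>d\<in>Atlas M.
        Cr_on (Model M) \<infinity> (snd c ` (fst c \<inter> fst d)) (local_rep c d (\<lambda>p. p)))"

definition charts_at :: "('a, 'e) mfd \<Rightarrow> 'a \<Rightarrow> ('a, 'e) chart set" where
  "charts_at M x = {c \<in> Atlas M. x \<in> fst c}"

definition mfd_Cr_on ::
  "enat \<Rightarrow> ('a, 'e::real_normed_vector) mfd \<Rightarrow> ('b, 'f::real_normed_vector) mfd
     \<Rightarrow> 'a set \<Rightarrow> ('a \<Rightarrow> 'b) \<Rightarrow> bool" where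
  "mfd_Cr_on r M N S f \<longleftrightarrow>
     openin (Top M) S \<and> f ` S \<subseteq> Points N \<and>
     (\<forall>p\<in>S. \<exists>c\<in>charts_at M p. \<exists>d\<in>charts_at N (f p). \<exists>T.
        openin (Top M) T \<and> p \<in> T \<and> T \<subseteq> S \<inter> fst c \<and> f ` T \<subseteq> fst d \<and>
        Cr_on (Model M) r (snd c ` T) (local_rep c d f))"

definition mfd_Cr_at ::
  "enat \<Rightarrow> ('a, 'e::real_normed_vector) mfd \<Rightarrow> ('b, 'f::real_normed_vector) mfd
     \<Rightarrow> ('a \<Rightarrow> 'b) \<Rightarrow> 'a \<Rightarrow> bool" where
  "mfd_Cr_at r M N f x \<longleftrightarrow> (\<exists>S. x \<in> S \<and> mfd_Cr_on r M N S f)"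


subsection \<open>Tangent spaces and differentials\<close>

text \<open>
  A tangent vector at \<open>x\<close> is given by its coordinate vectors in all the charts around \<open>x\<close>, which
  are related by the derivatives of the transition maps.  The vector space structure is pointwise.
  (Derivations of smooth functions would not do, since C^1 maps do not push them forward.)
\<close>

definition rep_deriv ::
  "('a, 'e::real_normed_vector) mfd \<Rightarrow> ('a, 'e) chart \<Rightarrow> ('b, 'f::real_normed_vector) chart
     \<Rightarrow> ('a \<Rightarrow> 'b) \<Rightarrow> 'a \<Rightarrow> 'e \<Rightarrow> 'f" where
  "rep_deriv M c d f x = frechet_derivative (local_rep c d f) (at (snd c x) within Model M)"

definition tangent_space ::
  "('a, 'e::real_normed_vector) mfd \<Rightarrow> 'a \<Rightarrow> (('a, 'e) chart \<Rightarrow> 'e) set" where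
  "tangent_space M x =
     {\<xi> \<in> charts_at M x \<rightarrow>\<^sub>E Model M.
        \<forall>c\<in>charts_at M x. \<forall>d\<in>charts_at M x. \<xi> d = rep_deriv M c d (\<lambda>p. p) x (\<xi> c)}"

text \<open>
  The vector \<open>d\<^sub>x f(\<xi>)\<close> is the tangent vector whose coordinates are the images of those of \<open>\<xi>\<close> under
  the derivative of \<open>f\<close> in charts.  It exists, and is unique, as soon as \<open>f\<close> is C^1 at \<open>x\<close>.
\<close>

definition differential ::
  "('a, 'e::real_normed_vector) mfd \<Rightarrow> ('b, 'f::real_normed_vector) mfd
     \<Rightarrow> ('a \<Rightarrow> 'b) \<Rightarrow> 'a \<Rightarrow> (('a, 'e) chart \<Rightarrow> 'e) \<Rightarrow> ('b, 'f) chart \<Rightarrow> 'f" where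
  "differential M N f x \<xi> =
     (THE \<eta>. \<eta> \<in> tangent_space N (f x) \<and>
        (\<forall>c\<in>charts_at M x. \<forall>d\<in>charts_at N (f x). \<eta> d = rep_deriv M c d f x (\<xi> c)))"


subsection \<open>A vector space as a manifold\<close>

definition vector_mfd :: "'e::real_normed_vector set \<Rightarrow> ('e, 'e) mfd" where
  "vector_mfd E = \<lparr>Top = top_of_set E, Model = E, Atlas = {(E, \<lambda>p. p)}\<rparr>"

text \<open>The canonical identification of the tangent spaces of \<open>vector_mfd E\<close> with \<open>E\<close>.\<close>

definition to_tangent :: "'e set \<Rightarrow> 'e \<Rightarrow> ('e, 'e) chart \<Rightarrow> 'e" where
  "to_tangent E v = (\<lambda>c\<in>{(E, \<lambda>p. p)}. v)"

definition from_tangent :: "'e set \<Rightarrow> (('e, 'e) chart \<Rightarrow> 'e) \<Rightarrow> 'e" where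
  "from_tangent E \<xi> = \<xi> (E, \<lambda>p. p)"


section \<open>Barcodes\<close>

text \<open>
  Multisets with possibly infinite multiplicities are functions into \<open>enat\<close>, and union adds
  multiplicities.  The set \<open>\<real> \<union> {+\<infinity>}\<close> is \<open>ereal\<close> without \<open>-\<infinity>\<close>.
\<close>

type_synonym barcode = "real \<times> ereal \<Rightarrow> enat"

definition Diag_inf :: barcode where
  "Diag_inf = (\<lambda>(b, d). if d = ereal b then \<infinity> else 0)"

definition add_diag :: "(real \<times> ereal) multiset \<Rightarrow> barcode" where
  "add_diag D = (\<lambda>p. enat (count D p) + Diag_inf p)"

definition Bar :: "barcode set" where
  "Bar = {add_diag D | D. \<forall>p\<in>#D. snd p \<noteq> -\<infinity>}"

text \<open>
  \<open>\<real>\<^sup>n\<close> with \<open>n\<close> a variable natural number: the sequences that vanish from index \<open>n\<close> on, inside the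
  normed space of bounded real sequences (\<open>nat\<close> is discrete, so continuity is no condition).
  Coordinates are numbered from 0.
\<close>

type_synonym rseq = "nat \<Rightarrow>\<^sub>C real"

definition Rn :: "nat \<Rightarrow> rseq set" where
  "Rn n = {x. \<forall>i\<ge>n. apply_bcontfun x i = 0}"

definition param_space :: "nat \<Rightarrow> nat \<Rightarrow> (rseq \<times> rseq) set" where
  "param_space m n = Rn (2 * m) \<times> Rn n"

abbreviation param_mfd :: "nat \<Rightarrow> nat \<Rightarrow> (rseq \<times> rseq, rseq \<times> rseq) mfd" where
  "param_mfd m n \<equiv> vector_mfd (param_space m n)"

text \<open>The coordinates \<open>b, d\<close> of the \<open>i\<close>-th bounded interval have index \<open>2 * i\<close> and \<open>2 * i + 1\<close>.\<close>

definition Q :: "nat \<Rightarrow> nat \<Rightarrow> rseq \<times> rseq \<Rightarrow> barcode" where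
  "Q m n = (\<lambda>(x, v). add_diag
     ({#(apply_bcontfun x (2 * i), ereal (apply_bcontfun x (2 * i + 1))). i \<in># mset_set {..<m}#} +
      {#(apply_bcontfun v j, \<infinity>). j \<in># mset_set {..<n}#}))"


section \<open>Differentiability for maps to and from barcodes\<close>

definition local_lift ::
  "enat \<Rightarrow> ('a, 'e::real_normed_vector) mfd \<Rightarrow> ('a \<Rightarrow> barcode) \<Rightarrow> 'a
     \<Rightarrow> 'a set \<Rightarrow> nat \<Rightarrow> nat \<Rightarrow> ('a \<Rightarrow> rseq \<times> rseq) \<Rightarrow> bool" where
  "local_lift r M B x U m n B' \<longleftrightarrow>
     openin (Top M) U \<and> x \<in> U \<and> mfd_Cr_on r M (param_mfd m n) U B' \<and>
     (\<forall>u\<in>U. B u = Q m n (B' u))"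

definition differentiable_to_Bar ::
  "enat \<Rightarrow> ('a, 'e::real_normed_vector) mfd \<Rightarrow> ('a \<Rightarrow> barcode) \<Rightarrow> 'a \<Rightarrow> bool" where
  "differentiable_to_Bar r M B x \<longleftrightarrow> (\<exists>U m n B'. local_lift r M B x U m n B')"

definition differential_to_Bar ::
  "('a, 'e::real_normed_vector) mfd \<Rightarrow> nat \<Rightarrow> nat \<Rightarrow> ('a \<Rightarrow> rseq \<times> rseq) \<Rightarrow> 'a
     \<Rightarrow> (('a, 'e) chart \<Rightarrow> 'e) \<Rightarrow> rseq \<times> rseq" where
  "differential_to_Bar M m n B' x \<xi> =
     from_tangent (param_space m n) (differential M (param_mfd m n) B' x \<xi>)"

definition differentiable_from_Bar ::
  "enat \<Rightarrow> ('b, 'f::real_normed_vector) mfd \<Rightarrow> (barcode \<Rightarrow> 'b) \<Rightarrow> barcode \<Rightarrow> bool" where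
  "differentiable_from_Bar r N V D \<longleftrightarrow>
     (\<forall>m n. \<forall>D'\<in>param_space m n. Q m n D' = D \<longrightarrow> mfd_Cr_at r (param_mfd m n) N (V \<circ> Q m n) D')"

definition differential_from_Bar ::
  "('b, 'f::real_normed_vector) mfd \<Rightarrow> (barcode \<Rightarrow> 'b) \<Rightarrow> nat \<Rightarrow> nat \<Rightarrow> rseq \<times> rseq
     \<Rightarrow> rseq \<times> rseq \<Rightarrow> ('b, 'f) chart \<Rightarrow> 'f" where
  "differential_from_Bar N V m n D' w =
     differential (param_mfd m n) N (V \<circ> Q m n) D' (to_tangent (param_space m n) w)"

end

theory Submission
  imports Defs
begin

text \<open>
  If \<open>B'\<close> is a local lift of \<open>B\<close> around \<open>x\<close>, then \<open>V \<circ> B = (V \<circ> Q m n) \<circ> B'\<close> near \<open>x\<close>. Both factors are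
  maps between manifolds: \<open>B'\<close> is of class C^r by the choice of the lift, and \<open>V \<circ> Q m n\<close> is of class
  C^r near \<open>B' x\<close> because \<open>B' x\<close> is one of the preimages of \<open>B x\<close> over which the differentiability of
  \<open>V\<close> quantifies. So the barcodes disappear, and the two claims become two standard facts: maps of class
  C^r compose (\<open>mfd_Cr_compose_through_vector_space\<close>), and differentials satisfy the chain rule
  (\<open>differential_compose\<close>).

  The regularity claim rests on \<open>Ck_on_compose\<close>. As derivatives are only controlled in fixed directions,
  its induction expands the inner derivative in coordinates of the middle space, which here is a
  parameter space \<open>\<real>\<^sup>2\<^sup>m \<times> \<real>\<^sup>n\<close> with its standard coordinates.

  The chain rule involves changes of charts, because the differential is defined by its effect in all
  charts at once, but only first derivatives, which compose without any choice of coordinates.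
  The differential of \<open>f\<close> is a definite description. Its conditions prescribe all coordinates, so there
  is at most one solution (\<open>differential_eqI\<close>); that these coordinates are consistent
  (\<open>differential_coordinates\<close>) is again the chain rule, applied to compositions of \<open>f\<close> with the
  identity. Model spaces are subspaces of normed spaces, where a derivative is unique
  only on vectors of the subspace (\<open>has_derivative_unique_on_subspace\<close>), and where one has to
  check that it takes values in the model space of the target (\<open>derivative_in_closed_subspace\<close>). The
  latter uses that finite-dimensional subspaces are closed (\<open>closed_span_finite\<close>).
\<close>

section \<open>Derivatives within a linear subspace\<close>

lemma at_within_openin_subset:
  fixes x :: "'a::topological_space"
  assumes "openin (top_of_set E) W" "x \<in> W"
  shows "at x within W = at x within E"
proof -
  obtain Z where "open Z" "W = E \<inter> Z"
    using assms(1) by (auto simp: openin_open)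
  then show ?thesis
    using assms(2) by (intro at_within_nhd[of _ Z]) auto
qed

text \<open>
  A derivative within a subspace \<open>E\<close> is determined only on vectors of \<open>E\<close>. All information on these
  vectors is recovered from the lines \<open>t \<mapsto> y + t v\<close> with \<open>v \<in> E\<close>, which stay inside \<open>E\<close>.
\<close>

lemma directional_derivative_in_subspace:
  fixes h :: "'e::real_normed_vector \<Rightarrow> 'f::real_normed_vector"
  assumes "subspace E" "y \<in> E" "v \<in> E"
    and "(h has_derivative A) (at y within E)"
  shows "((\<lambda>t. h (y + t *\<^sub>R v)) has_vector_derivative A v) (at 0)"
proof -
  have line: "((\<lambda>t. y + t *\<^sub>R v) has_derivative (\<lambda>t. t *\<^sub>R v)) (at (0::real))"
    by (auto intro!: derivative_eq_intros)
  have "range (\<lambda>t::real. y + t *\<^sub>R v) \<subseteq> E"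
    using assms(1-3) by (auto intro: subspace_add subspace_scale)
  then have "(h has_derivative A) (at (y + 0 *\<^sub>R v) within range (\<lambda>t::real. y + t *\<^sub>R v))"
    using assms(4) by (auto intro: has_derivative_subset)
  from has_derivative_in_compose[OF line this]
  have "((\<lambda>t. h (y + t *\<^sub>R v)) has_derivative (\<lambda>t. A (t *\<^sub>R v))) (at 0)" .
  moreover have "linear A"
    using assms(4) has_derivative_linear by blast
  ultimately show ?thesis
    by (simp add: has_vector_derivative_def linear_scale)
qed

lemma has_derivative_unique_on_subspace:
  assumes "subspace E" "y \<in> E" "v \<in> E"
    and "(h has_derivative A) (at y within E)" "(h has_derivative A') (at y within E)"
  shows "A v = A' v"
  by (rule vector_derivative_unique_at[OF directional_derivative_in_subspace[OF assms(1-4)]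
        directional_derivative_in_subspace[OF assms(1-3,5)]])

text \<open>
  Difference quotients of a map into a subspace stay in the subspace; closedness lets the limit stay
  there too. This makes derivatives of chart representations composable and keeps coordinate vectors
  of tangent vectors inside the model space.
\<close>

lemma derivative_in_closed_subspace:
  fixes h :: "'e::real_normed_vector \<Rightarrow> 'f::real_normed_vector"
  assumes "subspace E" "openin (top_of_set E) W" "y \<in> W" "v \<in> E"
    and "(h has_derivative A) (at y within E)"
    and "h ` W \<subseteq> F" "subspace F" "closed F"
  shows "A v \<in> F"
proof -
  obtain Z where Z: "open Z" "W = E \<inter> Z"
    using assms(2) by (auto simp: openin_open)
  have "y \<in> E" "y \<in> Z" using Z assms(3) by auto
  let ?q = "\<lambda>t. (h (y + t *\<^sub>R v) - h y) /\<^sub>R t"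
  have "((\<lambda>t. h (y + t *\<^sub>R v)) has_vector_derivative A v) (at 0)"
    by (rule directional_derivative_in_subspace[OF assms(1) \<open>y \<in> E\<close> assms(4,5)])
  then have remainder: "((\<lambda>t. norm (h (y + t *\<^sub>R v) - h y - t *\<^sub>R A v) / norm t) \<longlongrightarrow> 0) (at 0)"
    by (simp add: has_vector_derivative_def has_derivative_iff_norm)
  have "eventually (\<lambda>t. norm (h (y + t *\<^sub>R v) - h y - t *\<^sub>R A v) / norm t = norm (?q t - A v))
    (at (0::real))"
    unfolding eventually_at_filter
  proof (intro always_eventually allI impI)
    fix t :: real
    assume "t \<noteq> 0"
    then have "?q t - A v = (h (y + t *\<^sub>R v) - h y - t *\<^sub>R A v) /\<^sub>R t"
      by (simp add: scaleR_diff_right)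
    then show "norm (h (y + t *\<^sub>R v) - h y - t *\<^sub>R A v) / norm t = norm (?q t - A v)"
      by (simp add: divide_inverse mult.commute)
  qed
  from Lim_transform_eventually[OF remainder this]
  have "((\<lambda>t. norm (?q t - A v)) \<longlongrightarrow> 0) (at 0)" .
  then have lim: "(?q \<longlongrightarrow> A v) (at 0)"
    by (rule LIM_zero_cancel[OF tendsto_norm_zero_cancel])
  have "((\<lambda>t. y + t *\<^sub>R v) \<longlongrightarrow> y + 0 *\<^sub>R v) (at (0::real))"
    by (intro tendsto_intros)
  then have "eventually (\<lambda>t. y + t *\<^sub>R v \<in> Z) (at (0::real))"
    using Z(1) \<open>y \<in> Z\<close> by (simp add: topological_tendstoD)
  then have "eventually (\<lambda>t. ?q t \<in> F) (at (0::real))"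
  proof eventually_elim
    case (elim t)
    then have "y + t *\<^sub>R v \<in> W"
      using Z(2) assms(1,4) \<open>y \<in> E\<close> by (auto intro: subspace_add subspace_scale)
    then show ?case
      using assms(3,6,7) by (auto intro!: subspace_scale subspace_diff)
  qed
  then show ?thesis
    by (intro Lim_in_closed_set[OF assms(8) _ _ lim]) auto
qed

text \<open>
  If \<open>a\<close> has distance \<open>\<delta> > 0\<close> from the closed subspace \<open>span S\<close>, then \<open>\<bar>t\<bar> \<delta> \<le> \<parallel>t a + s\<parallel>\<close>, so the
  coefficients at \<open>a\<close> of a convergent sequence in \<open>span (insert a S)\<close> form a Cauchy sequence.
\<close>

lemma closed_span_finite:
  fixes S :: "'e::real_normed_vector set"
  assumes "finite S"
  shows "closed (span S)"
  using assms
proof (induction S rule: finite_induct)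
  case empty
  then show ?case by simp
next
  case (insert a S)
  show ?case
  proof (cases "a \<in> span S")
    case True
    then show ?thesis using insert.IH by (simp add: span_redundant)
  next
    case False
    obtain \<delta> where ball: "\<delta> > 0" "ball a \<delta> \<subseteq> - span S"
      using False insert.IH unfolding closed_def open_contains_ball by auto
    have \<delta>: "\<delta> \<le> dist s a" if "s \<in> span S" for s
      using ball(2) that by (auto simp: subset_iff dist_commute not_less[symmetric])
    have gap: "\<bar>t\<bar> * \<delta> \<le> norm (t *\<^sub>R a + s)" if "s \<in> span S" for t s
    proof (cases "t = 0")
      case False
      have "\<delta> \<le> dist ((- 1 / t) *\<^sub>R s) a"
        using \<delta> that by (simp add: span_scale span_neg)
      also have "\<dots> = norm (a + (1 / t) *\<^sub>R s)"
        by (simp add: dist_norm norm_minus_commute)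
      finally have "\<bar>t\<bar> * \<delta> \<le> norm (t *\<^sub>R (a + (1 / t) *\<^sub>R s))"
        by (simp add: mult_left_mono)
      then show ?thesis using False by (simp add: scaleR_add_right)
    qed simp
    show ?thesis
      unfolding closed_sequential_limits
    proof (intro allI impI, elim conjE)
      fix z l
      assume z: "\<forall>n. z n \<in> span (insert a S)" and lim: "z \<longlonglongrightarrow> l"
      obtain t where t: "\<And>n. z n - t n *\<^sub>R a \<in> span S"
        using z unfolding span_insert by (auto dest!: choice)
      have step: "\<bar>t m - t n\<bar> * \<delta> \<le> norm (z m - z n)" for m n
        using gap[OF span_diff[OF t[of m] t[of n]], of "t m - t n"]
        by (simp add: scaleR_diff_left)
      have "Cauchy t"
      proof (rule CauchyI)
        fix e :: real assume "e > 0"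
        then obtain K where "\<forall>m\<ge>K. \<forall>n\<ge>K. norm (z m - z n) < e * \<delta>"
          using LIMSEQ_imp_Cauchy[OF lim] ball(1) by (meson CauchyD mult_pos_pos)
        then show "\<exists>K. \<forall>m\<ge>K. \<forall>n\<ge>K. norm (t m - t n) < e"
          using step ball(1) by (metis le_less_trans mult_less_cancel_right_pos real_norm_def)
      qed
      then obtain u where "t \<longlonglongrightarrow> u"
        using Cauchy_convergent convergent_def by blast
      then have "(\<lambda>n. z n - t n *\<^sub>R a) \<longlonglongrightarrow> l - u *\<^sub>R a"
        by (intro tendsto_intros lim)
      from closed_sequentially[OF insert.IH t this] have "l - u *\<^sub>R a \<in> span S" .
      then show "l \<in> span (insert a S)"
        unfolding span_insert by blast
    qed
  qed
qed

section \<open>Calculus of C^k maps\<close>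

lemma Ck_on_SucI:
  assumes "\<And>x. x \<in> W \<Longrightarrow> (f has_derivative D x) (at x within W)"
    and "\<And>v. v \<in> E \<Longrightarrow> Ck_on E k W (\<lambda>x. D x v)"
  shows "Ck_on E (Suc k) W f"
  unfolding Ck_on.simps using assms by (intro exI[of _ D] conjI ballI)

lemma Ck_on_SucE:
  assumes "Ck_on E (Suc k) W f"
  obtains D where "\<And>x. x \<in> W \<Longrightarrow> (f has_derivative D x) (at x within W)"
    and "\<And>v. v \<in> E \<Longrightarrow> Ck_on E k W (\<lambda>x. D x v)"
  using assms unfolding Ck_on.simps by metis

lemma Ck_on_subset: "Ck_on E k W f \<Longrightarrow> W' \<subseteq> W \<Longrightarrow> Ck_on E k W' f"
proof (induction k arbitrary: f)
  case 0
  then show ?case by (auto intro: continuous_on_subset)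
next
  case (Suc k)
  from Suc.prems(1) obtain D where D: "\<And>x. x \<in> W \<Longrightarrow> (f has_derivative D x) (at x within W)"
    "\<And>v. v \<in> E \<Longrightarrow> Ck_on E k W (\<lambda>x. D x v)"
    by (rule Ck_on_SucE) blast
  show ?case
  proof (rule Ck_on_SucI)
    show "(f has_derivative D x) (at x within W')" if "x \<in> W'" for x
      using D(1) Suc.prems(2) that by (meson has_derivative_subset subsetD)
    show "Ck_on E k W' (\<lambda>x. D x v)" if "v \<in> E" for v
      using Suc.IH D(2) Suc.prems(2) that by blast
  qed
qed

lemma Ck_on_cong:
  assumes "\<And>x. x \<in> W \<Longrightarrow> f x = g x" "Ck_on E k W f"
  shows "Ck_on E k W g"
proof (cases k)
  case 0
  then show ?thesis using assms continuous_on_cong by force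
next
  case (Suc l)
  from assms(2) obtain D where D: "\<And>x. x \<in> W \<Longrightarrow> (f has_derivative D x) (at x within W)"
    "\<And>v. v \<in> E \<Longrightarrow> Ck_on E l W (\<lambda>x. D x v)"
    unfolding Suc by (rule Ck_on_SucE) blast
  have "(g has_derivative D x) (at x within W)" if "x \<in> W" for x
    using has_derivative_transform[of x W g f] that assms(1) D(1) by auto
  then show ?thesis using D(2) Suc Ck_on_SucI by blast
qed

lemma Ck_on_SucD: "Ck_on E (Suc k) W f \<Longrightarrow> Ck_on E k W f"
proof (induction k arbitrary: f)
  case 0
  then obtain D where "\<And>x. x \<in> W \<Longrightarrow> (f has_derivative D x) (at x within W)"
    by (rule Ck_on_SucE) blast
  then show ?case
    using has_derivative_continuous_on[of W f D] by simp
next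
  case (Suc k)
  from Suc.prems obtain D where D: "\<And>x. x \<in> W \<Longrightarrow> (f has_derivative D x) (at x within W)"
    "\<And>v. v \<in> E \<Longrightarrow> Ck_on E (Suc k) W (\<lambda>x. D x v)"
    by (rule Ck_on_SucE) blast
  show ?case by (rule Ck_on_SucI[OF D(1) Suc.IH[OF D(2)]])
qed

lemma Ck_on_const: "Ck_on E k W (\<lambda>x. c)"
proof (induction k arbitrary: c)
  case (Suc k)
  then show ?case by (intro Ck_on_SucI[where D = "\<lambda>x v. 0"] has_derivative_const)
qed simp

lemma Ck_on_add:
  "Ck_on E k W f \<Longrightarrow> Ck_on E k W g \<Longrightarrow> Ck_on E k W (\<lambda>x. f x + g x)"
proof (induction k arbitrary: f g)
  case 0
  then show ?case by (auto intro: continuous_on_add)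
next
  case (Suc k)
  from Suc.prems(1) obtain D where D: "\<And>x. x \<in> W \<Longrightarrow> (f has_derivative D x) (at x within W)"
    "\<And>v. v \<in> E \<Longrightarrow> Ck_on E k W (\<lambda>x. D x v)"
    by (rule Ck_on_SucE) blast
  from Suc.prems(2) obtain D' where D': "\<And>x. x \<in> W \<Longrightarrow> (g has_derivative D' x) (at x within W)"
    "\<And>v. v \<in> E \<Longrightarrow> Ck_on E k W (\<lambda>x. D' x v)"
    by (rule Ck_on_SucE) blast
  from D D' show ?case
    by (intro Ck_on_SucI[where D = "\<lambda>x v. D x v + D' x v"] has_derivative_add Suc.IH)
qed

lemma Ck_on_sum:
  assumes "\<And>i. i \<in> I \<Longrightarrow> Ck_on E k W (f i)"
  shows "Ck_on E k W (\<lambda>x. \<Sum>i\<in>I. f i x)"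
  using assms
  by (induction I rule: infinite_finite_induct) (simp_all add: Ck_on_const Ck_on_add)

lemma Ck_on_bounded_linear:
  assumes L: "bounded_linear L"
  shows "Ck_on E k W f \<Longrightarrow> Ck_on E k W (\<lambda>x. L (f x))"
proof (induction k arbitrary: f)
  case 0
  then show ?case
    using bounded_linear.continuous_on[OF L] by simp
next
  case (Suc k)
  from Suc.prems obtain D where D: "\<And>x. x \<in> W \<Longrightarrow> (f has_derivative D x) (at x within W)"
    "\<And>v. v \<in> E \<Longrightarrow> Ck_on E k W (\<lambda>x. D x v)"
    by (rule Ck_on_SucE) blast
  then show ?case
    by (intro Ck_on_SucI[where D = "\<lambda>x v. L (D x v)"] bounded_linear.has_derivative[OF L] Suc.IH)
qed

lemma Ck_on_scaleR:
  "Ck_on E k W a \<Longrightarrow> Ck_on E k W b \<Longrightarrow> Ck_on E k W (\<lambda>x. a x *\<^sub>R b x)"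
proof (induction k arbitrary: a b)
  case 0
  then show ?case by (auto intro: continuous_on_scaleR)
next
  case (Suc k)
  from Suc.prems(1) obtain D where D: "\<And>x. x \<in> W \<Longrightarrow> (a has_derivative D x) (at x within W)"
    "\<And>v. v \<in> E \<Longrightarrow> Ck_on E k W (\<lambda>x. D x v)"
    by (rule Ck_on_SucE) blast
  from Suc.prems(2) obtain D' where D': "\<And>x. x \<in> W \<Longrightarrow> (b has_derivative D' x) (at x within W)"
    "\<And>v. v \<in> E \<Longrightarrow> Ck_on E k W (\<lambda>x. D' x v)"
    by (rule Ck_on_SucE) blast
  from D D' Suc.prems[THEN Ck_on_SucD] show ?case
    by (intro Ck_on_SucI[where D = "\<lambda>x v. a x *\<^sub>R D' x v + D x v *\<^sub>R b x"]
        has_derivative_scaleR Ck_on_add Suc.IH)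
qed

text \<open>
  The \<open>\<phi> i\<close> are bounded functionals on the whole ambient space, not only on \<open>F\<close>: postcomposition with
  \<open>\<phi> i\<close> must turn derivatives, which are bounded linear on the ambient space, into such derivatives.
  For an arbitrary finite-dimensional subspace this would call for the Hahn-Banach theorem; for spaces
  of sequences the coordinates themselves serve.
\<close>

definition coordinate_frame ::
  "'f::real_normed_vector set \<Rightarrow> 'i set \<Rightarrow> ('i \<Rightarrow> 'f \<Rightarrow> real) \<Rightarrow> ('i \<Rightarrow> 'f) \<Rightarrow> bool" where
  "coordinate_frame F I \<phi> e \<longleftrightarrow>
     finite I \<and> (\<forall>i\<in>I. bounded_linear (\<phi> i) \<and> e i \<in> F) \<and> (\<forall>w\<in>F. w = (\<Sum>i\<in>I. \<phi> i w *\<^sub>R e i))"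

text \<open>
  The derivative of \<open>g \<circ> f\<close> in direction \<open>v\<close> is \<open>x \<mapsto> Dg (f x) (Df x v)\<close>, where the direction in which
  \<open>g\<close> is differentiated varies with \<open>x\<close>, whereas class C^k controls \<open>Dg\<close> only in fixed directions. A
  frame of \<open>F\<close> separates the two: this derivative equals \<open>\<Sum>i. \<phi> i (Df x v) Dg (f x) (e i)\<close>, a sum of
  products of C^k functions by the induction hypothesis.
\<close>

lemma Ck_on_compose:
  fixes f :: "'e::real_normed_vector \<Rightarrow> 'f::real_normed_vector"
    and g :: "'f \<Rightarrow> 'g::real_normed_vector"
  assumes E: "subspace E" "openin (top_of_set E) W"
    and F: "subspace F" "closed F" "coordinate_frame F I \<phi> e"
    and fW: "f ` W \<subseteq> W'" "W' \<subseteq> F"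
    and f: "Ck_on E k W f"
  shows "Ck_on F k W' g \<Longrightarrow> Ck_on E k W (\<lambda>x. g (f x))"
  using f
proof (induction k arbitrary: g)
  case 0
  then show ?case using fW(1) continuous_on_compose2 by fastforce
next
  case (Suc k)
  from Suc.prems(2) obtain D where D: "\<And>x. x \<in> W \<Longrightarrow> (f has_derivative D x) (at x within W)"
    "\<And>v. v \<in> E \<Longrightarrow> Ck_on E k W (\<lambda>x. D x v)"
    by (rule Ck_on_SucE) blast
  from Suc.prems(1) obtain D' where D': "\<And>y. y \<in> W' \<Longrightarrow> (g has_derivative D' y) (at y within W')"
    "\<And>w. w \<in> F \<Longrightarrow> Ck_on F k W' (\<lambda>y. D' y w)"
    by (rule Ck_on_SucE) blast
  have "((\<lambda>x. g (f x)) has_derivative (\<lambda>v. D' (f x) (D x v))) (at x within W)" if "x \<in> W" for x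
    using has_derivative_in_compose[OF D(1)[OF that] has_derivative_subset[OF D'(1)]] fW(1) that
    by blast
  moreover have "Ck_on E k W (\<lambda>x. D' (f x) (D x v))" if v: "v \<in> E" for v
  proof (rule Ck_on_cong)
    show "Ck_on E k W (\<lambda>x. \<Sum>i\<in>I. \<phi> i (D x v) *\<^sub>R D' (f x) (e i))"
    proof (intro Ck_on_sum Ck_on_scaleR)
      fix i assume "i \<in> I"
      then show "Ck_on E k W (\<lambda>x. \<phi> i (D x v))"
        using F(3) D(2)[OF v] Ck_on_bounded_linear unfolding coordinate_frame_def by blast
      show "Ck_on E k W (\<lambda>x. D' (f x) (e i))"
        using Suc.IH[OF D'(2) Ck_on_SucD[OF Suc.prems(2)]] F(3) \<open>i \<in> I\<close>
        unfolding coordinate_frame_def by blast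
    qed
    fix x assume x: "x \<in> W"
    have "f ` W \<subseteq> F" using fW by auto
    then have "D x v \<in> F"
      using derivative_in_closed_subspace[OF E x v _ _ F(1,2)] D(1)[OF x]
        at_within_openin_subset[OF E(2) x] by auto
    then have "D x v = (\<Sum>i\<in>I. \<phi> i (D x v) *\<^sub>R e i)"
      using F(3) unfolding coordinate_frame_def by blast
    then have "D' (f x) (D x v) = D' (f x) (\<Sum>i\<in>I. \<phi> i (D x v) *\<^sub>R e i)"
      by (rule arg_cong)
    also have "\<dots> = (\<Sum>i\<in>I. \<phi> i (D x v) *\<^sub>R D' (f x) (e i))"
      using has_derivative_linear[OF D'(1)[of "f x"]] fW(1) x
      by (simp add: image_subset_iff linear_sum linear_scale)
    finally show "(\<Sum>i\<in>I. \<phi> i (D x v) *\<^sub>R D' (f x) (e i)) = D' (f x) (D x v)"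
      by (rule sym)
  qed
  ultimately show ?case by (rule Ck_on_SucI)
qed

section \<open>Maps read in charts\<close>

lemma chart_domain_open: "is_chart X E c \<Longrightarrow> openin X (fst c)"
  by (simp add: is_chart_def)

lemma chart_image_in_model: "is_chart X E c \<Longrightarrow> p \<in> fst c \<Longrightarrow> snd c p \<in> E"
  using openin_imp_subset unfolding is_chart_def by blast

lemma chart_inj:
  assumes "is_chart X E c"
  shows "inj_on (snd c) (fst c)"
proof -
  have "topspace (subtopology X (fst c)) = fst c"
    using openin_subset[OF chart_domain_open[OF assms]] by (simp add: Int_absorb1)
  then show ?thesis
    using assms homeomorphic_imp_injective_map unfolding is_chart_def by metis
qed

lemma chart_image_open:
  assumes "is_chart X E c" "openin X T" "T \<subseteq> fst c"
  shows "openin (top_of_set E) (snd c ` T)"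
proof -
  have "openin (subtopology X (fst c)) T"
    using assms by (simp add: openin_open_subtopology chart_domain_open)
  then have "openin (top_of_set (snd c ` fst c)) (snd c ` T)"
    using assms(1) homeomorphic_imp_open_map unfolding is_chart_def open_map_def by metis
  then show ?thesis
    using assms(1) openin_trans unfolding is_chart_def by blast
qed

lemma chart_preimage_open:
  assumes "is_chart X E c" "openin (top_of_set E) W"
  shows "openin X {p \<in> fst c. snd c p \<in> W}"
proof -
  have "continuous_map (subtopology X (fst c)) (top_of_set (snd c ` fst c)) (snd c)"
    using assms(1) homeomorphic_imp_continuous_map unfolding is_chart_def by blast
  moreover have "openin (top_of_set (snd c ` fst c)) (snd c ` fst c \<inter> W)"
  proof -
    have "snd c ` fst c \<subseteq> E"
      using chart_image_in_model[OF assms(1)] by blast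
    then show ?thesis
      using assms(2) by (auto simp: openin_open)
  qed
  ultimately have "openin (subtopology X (fst c))
      {p \<in> topspace (subtopology X (fst c)). snd c p \<in> snd c ` fst c \<inter> W}"
    by (rule openin_continuous_map_preimage)
  moreover have "{p \<in> topspace (subtopology X (fst c)). snd c p \<in> snd c ` fst c \<inter> W} =
      {p \<in> fst c. snd c p \<in> W}"
    using openin_subset[OF chart_domain_open[OF assms(1)]] by auto
  ultimately show ?thesis
    by (simp add: openin_open_subtopology chart_domain_open[OF assms(1)])
qed

lemma local_rep_chart [simp]:
  "is_chart X E c \<Longrightarrow> p \<in> fst c \<Longrightarrow> local_rep c d f (snd c p) = snd d (f p)"
  by (simp add: local_rep_def chart_inj)

text \<open>
  Near \<open>snd c x\<close> the representation of \<open>g \<circ> f\<close> is the composition of the representations of \<open>f\<close> and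
  \<open>g\<close>. Taking \<open>f\<close> or \<open>g\<close> to be the identity also covers changes of charts, and the map \<open>h\<close>, which
  agrees with \<open>g \<circ> f\<close> only near \<open>x\<close>, covers maps that factor only locally.
\<close>

lemma has_derivative_local_rep_compose:
  assumes c: "is_chart X E c" and d: "is_chart Y F d"
    and T: "openin X T" "x \<in> T" "T \<subseteq> fst c" "f ` T \<subseteq> fst d"
    and h: "\<And>p. p \<in> T \<Longrightarrow> h p = g (f p)"
    and A: "(local_rep c d f has_derivative A) (at (snd c x) within E)"
    and C: "(local_rep d e g has_derivative C) (at (snd d (f x)) within F)"
  shows "(local_rep c e h has_derivative (\<lambda>v. C (A v))) (at (snd c x) within E)"
proof -
  let ?W = "snd c ` T"
  have W: "openin (top_of_set E) ?W" "snd c x \<in> ?W"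
    using chart_image_open[OF c T(1,3)] T(2) by auto
  have f_rep: "local_rep c d f (snd c p) = snd d (f p)" if "p \<in> T" for p
    using that T(3) c by (simp add: subset_iff)
  have sub: "local_rep c d f ` ?W \<subseteq> F"
    using chart_image_in_model[OF d] T(4) f_rep by (auto simp: image_subset_iff)
  have C': "(local_rep d e g has_derivative C) (at (local_rep c d f (snd c x)) within F)"
    using C f_rep[OF T(2)] by simp
  have A': "(local_rep c d f has_derivative A) (at (snd c x) within ?W)"
    using A at_within_openin_subset[OF W] by simp
  have chain: "((\<lambda>y. local_rep d e g (local_rep c d f y)) has_derivative (\<lambda>v. C (A v)))
      (at (snd c x) within ?W)"
    by (rule has_derivative_in_compose[OF A' has_derivative_subset[OF C' sub]])
  have same: "local_rep c e h y = local_rep d e g (local_rep c d f y)" if "y \<in> ?W" for y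
  proof -
    from that obtain p where p: "p \<in> T" "y = snd c p" by blast
    then have "p \<in> fst c" "f p \<in> fst d" using T(3,4) by auto
    then show ?thesis using p h c d by simp
  qed
  show ?thesis
    using has_derivative_transform[OF W(2) same chain] at_within_openin_subset[OF W] by simp
qed

text \<open>
  The C^0 condition is stated in charts; since charts are homeomorphisms onto open sets, it yields
  continuity for the topologies of the manifolds, and hence the open sets on which compositions are
  defined.
\<close>

lemma mfd_Cr_on_continuous:
  assumes M: "\<And>c. c \<in> Atlas M \<Longrightarrow> is_chart (Top M) (Model M) c"
    and N: "\<And>d. d \<in> Atlas N \<Longrightarrow> is_chart (Top N) (Model N) d"
    and f: "mfd_Cr_on r M N S f" and p: "p \<in> S"
    and Y: "openin (Top N) Y" "f p \<in> Y"
  obtains T where "openin (Top M) T" "p \<in> T" "T \<subseteq> S" "f ` T \<subseteq> Y"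
proof -
  obtain c d T where c: "c \<in> charts_at M p" and d: "d \<in> charts_at N (f p)"
    and T: "openin (Top M) T" "p \<in> T" "T \<subseteq> S \<inter> fst c" "f ` T \<subseteq> fst d"
    and Cr: "Cr_on (Model M) r (snd c ` T) (local_rep c d f)"
    using f p unfolding mfd_Cr_on_def by metis
  have c': "is_chart (Top M) (Model M) c" and d': "is_chart (Top N) (Model N) d"
    using M N c d by (auto simp: charts_at_def)
  have "Ck_on (Model M) 0 (snd c ` T) (local_rep c d f)"
    using Cr unfolding Cr_on_def by (metis zero_enat_def zero_le)
  then have cont: "continuous_on (snd c ` T) (local_rep c d f)" by simp
  have "openin (top_of_set (Model N)) (snd d ` (Y \<inter> fst d))"
    using Y(1) chart_domain_open[OF d'] by (intro chart_image_open[OF d']) auto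
  then obtain Z where Z: "open Z" "snd d ` (Y \<inter> fst d) = Model N \<inter> Z"
    by (auto simp: openin_open)
  have "openin (top_of_set (snd c ` T)) (snd c ` T \<inter> local_rep c d f -` Z)"
    using cont Z(1) by (rule continuous_openin_preimage_gen)
  moreover have "openin (top_of_set (Model M)) (snd c ` T)"
    using chart_image_open[OF c' T(1)] T(3) by blast
  ultimately have "openin (top_of_set (Model M)) (snd c ` T \<inter> local_rep c d f -` Z)"
    by (rule openin_trans)
  then have "openin (Top M) (T \<inter> {q \<in> fst c. snd c q \<in> snd c ` T \<inter> local_rep c d f -` Z})"
    using T(1) chart_preimage_open[OF c'] by blast
  moreover have "T \<inter> {q \<in> fst c. snd c q \<in> snd c ` T \<inter> local_rep c d f -` Z} =
      {q \<in> T. snd d (f q) \<in> Z}"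
  proof (rule set_eqI)
    fix q
    have "q \<in> T \<Longrightarrow> q \<in> fst c \<and> local_rep c d f (snd c q) = snd d (f q)"
      using T(3) c' by auto
    then show "q \<in> T \<inter> {q \<in> fst c. snd c q \<in> snd c ` T \<inter> local_rep c d f -` Z} \<longleftrightarrow>
        q \<in> {q \<in> T. snd d (f q) \<in> Z}"
      by (cases "q \<in> T") simp_all
  qed
  ultimately have preimage: "openin (Top M) {q \<in> T. snd d (f q) \<in> Z}" by simp
  have "snd d (f p) \<in> Z"
    using Z(2) Y(2) T(2,4) by blast
  moreover have "f q \<in> Y" if "q \<in> T" "snd d (f q) \<in> Z" for q
  proof -
    have "f q \<in> fst d" using that T(4) by blast
    then have "snd d (f q) \<in> snd d ` (Y \<inter> fst d)"
      using that chart_image_in_model[OF d'] Z(2) by blast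
    then show ?thesis
      using inj_onD[OF chart_inj[OF d']] \<open>f q \<in> fst d\<close> by blast
  qed
  ultimately show thesis
    using T by (intro that[OF preimage]) auto
qed

section \<open>Composition through a vector space\<close>

lemma vector_mfd_simps [simp]:
  "Top (vector_mfd E) = top_of_set E" "Model (vector_mfd E) = E"
  "Atlas (vector_mfd E) = {(E, \<lambda>p. p)}"
  by (simp_all add: vector_mfd_def)

lemma is_chart_vector_mfd: "is_chart (top_of_set E) E (E, \<lambda>p. p)"
  using homeomorphic_map_id[of "top_of_set E" "top_of_set E"]
  by (simp add: is_chart_def id_def subtopology_subtopology)

lemma charts_at_vector_mfd: "x \<in> E \<Longrightarrow> charts_at (vector_mfd E) x = {(E, \<lambda>p. p)}"
  by (auto simp: charts_at_def)

text \<open>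
  The middle manifold has the identity as its only chart, so the representations of \<open>f\<close> and \<open>g\<close> given
  by the definition of class C^r already fit together, with no transition map in between.
\<close>

lemma mfd_Cr_compose_through_vector_space:
  assumes M: "\<And>c. c \<in> Atlas M \<Longrightarrow> is_chart (Top M) (Model M) c" "subspace (Model M)"
    and F: "subspace F" "closed F" "coordinate_frame F I \<phi> e"
    and f: "mfd_Cr_on r M (vector_mfd F) S f" and g: "mfd_Cr_on r (vector_mfd F) N S' g"
    and h: "\<And>p. p \<in> S \<Longrightarrow> h p = g (f p)"
    and x: "x \<in> S" "f x \<in> S'"
  shows "mfd_Cr_at r M N h x"
proof -
  let ?S = "{p \<in> S. f p \<in> S'}"
  let ?d = "(F, \<lambda>p. p) :: (_, _) chart"
  have S'F: "S' \<subseteq> F"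
    using g openin_imp_subset unfolding mfd_Cr_on_def by fastforce
  have near: "\<exists>T2. openin (Top M) T2 \<and> p \<in> T2 \<and> T2 \<subseteq> S \<and> f ` T2 \<subseteq> Y"
    if "p \<in> S" "openin (top_of_set F) Y" "f p \<in> Y" for p Y
    using mfd_Cr_on_continuous[OF M(1) _ f that(1), of Y] that is_chart_vector_mfd[of F]
    by (metis empty_iff insert_iff vector_mfd_simps)
  have S': "openin (top_of_set F) S'"
    using g unfolding mfd_Cr_on_def by simp
  have open_S: "openin (Top M) ?S"
    unfolding openin_subopen[of _ ?S]
  proof
    fix p assume "p \<in> ?S"
    then obtain T where "openin (Top M) T" "p \<in> T" "T \<subseteq> S" "f ` T \<subseteq> S'"
      using near[OF _ S', of p] by auto
    then show "\<exists>T. openin (Top M) T \<and> p \<in> T \<and> T \<subseteq> ?S"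
      by (intro exI[of _ T]) auto
  qed
  have "mfd_Cr_on r M N ?S h"
    unfolding mfd_Cr_on_def
  proof (intro conjI ballI open_S)
    show "h ` ?S \<subseteq> Points N"
      using g h unfolding mfd_Cr_on_def by auto
    fix p assume p: "p \<in> ?S"
    obtain c T where c: "c \<in> charts_at M p"
      and T: "openin (Top M) T" "p \<in> T" "T \<subseteq> S \<inter> fst c"
      and fT: "Cr_on (Model M) r (snd c ` T) (local_rep c ?d f)"
    proof -
      have "charts_at (vector_mfd F) (f p) = {?d}"
        using p S'F by (intro charts_at_vector_mfd) auto
      then show thesis
        using f p that unfolding mfd_Cr_on_def by auto
    qed
    obtain d T' where d: "d \<in> charts_at N (g (f p))"
      and T': "openin (top_of_set F) T'" "f p \<in> T'" "T' \<subseteq> S'" "g ` T' \<subseteq> fst d"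
      and gT: "Cr_on F r T' (local_rep ?d d g)"
    proof -
      have "charts_at (vector_mfd F) (f p) = {?d}"
        using p S'F by (intro charts_at_vector_mfd) auto
      then show thesis
        using g p that unfolding mfd_Cr_on_def by auto
    qed
    obtain T2 where T2: "openin (Top M) T2" "p \<in> T2" "T2 \<subseteq> S" "f ` T2 \<subseteq> T'"
      using near[of p T'] p T' by blast
    have c': "is_chart (Top M) (Model M) c"
      using c M(1) by (auto simp: charts_at_def)
    let ?W = "snd c ` (T \<inter> T2)"
    have W: "openin (top_of_set (Model M)) ?W"
      using T T2 by (intro chart_image_open[OF c']) auto
    have f_rep: "local_rep c ?d f (snd c q) = f q" if "q \<in> T" for q
      using local_rep_chart[OF c', of q ?d f] that T(3) by auto
    have fW: "local_rep c ?d f ` ?W \<subseteq> T'"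
      using T2(4) f_rep by auto
    have T'F: "T' \<subseteq> F" using T'(3) S'F by blast
    have "Cr_on (Model M) r ?W (local_rep c d h)"
      unfolding Cr_on_def
    proof (intro allI impI)
      fix k assume k: "enat k \<le> r"
      have "Ck_on (Model M) k ?W (local_rep c ?d f)"
        using fT k unfolding Cr_on_def by (meson Ck_on_subset image_mono inf_le1)
      moreover have "Ck_on F k T' (local_rep ?d d g)"
        using gT k unfolding Cr_on_def by blast
      ultimately have chain: "Ck_on (Model M) k ?W (\<lambda>y. local_rep ?d d g (local_rep c ?d f y))"
        by (rule Ck_on_compose[OF M(2) W F fW T'F])
      have same: "local_rep ?d d g (local_rep c ?d f y) = local_rep c d h y" if "y \<in> ?W" for y
      proof -
        from that obtain q where q: "q \<in> T" "q \<in> T2" "y = snd c q" by blast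
        have "f q \<in> F" using q T2(4) T'F by blast
        then have "local_rep ?d d g (f q) = snd d (g (f q))"
          using local_rep_chart[OF is_chart_vector_mfd[of F], of "f q" d g] by simp
        moreover have "q \<in> fst c" "q \<in> S" using q T(3) by auto
        ultimately show ?thesis
          using q h f_rep c' by simp
      qed
      show "Ck_on (Model M) k ?W (local_rep c d h)"
        by (rule Ck_on_cong[OF same chain])
    qed
    moreover have "openin (Top M) (T \<inter> T2)" using T(1) T2(1) by blast
    moreover have "h ` (T \<inter> T2) \<subseteq> fst d" using h T2(3,4) T'(4) by (auto simp: subset_iff)
    moreover have "d \<in> charts_at N (h p)" using d h p by simp
    moreover have "T \<inter> T2 \<subseteq> ?S \<inter> fst c" using T(3) T2(3,4) T'(3) by auto
    ultimately show "\<exists>c\<in>charts_at M p. \<exists>d\<in>charts_at N (h p). \<exists>T.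
        openin (Top M) T \<and> p \<in> T \<and> T \<subseteq> ?S \<inter> fst c \<and> h ` T \<subseteq> fst d \<and>
        Cr_on (Model M) r (snd c ` T) (local_rep c d h)"
      using c T(2) T2(2)
      by (intro bexI[of _ c] bexI[of _ d] exI[of _ "T \<inter> T2"] conjI) (assumption | rule IntI)+
  qed
  then show ?thesis
    using x unfolding mfd_Cr_at_def by (intro exI[of _ ?S]) simp
qed

section \<open>Differentiable maps between manifolds\<close>

lemma subspace_finite_dim: "finite_dim_subspace E \<Longrightarrow> subspace E"
  and closed_finite_dim: "finite_dim_subspace E \<Longrightarrow> closed E"
  by (auto simp: finite_dim_subspace_def closed_span_finite)

lemma Cr_on_imp_has_derivative:
  assumes "Cr_on E r W f" "r \<ge> 1" "openin (top_of_set E) W" "y \<in> W"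
  obtains L where "(f has_derivative L) (at y within E)"
proof -
  have "Ck_on E (Suc 0) W f"
    using assms(1,2) unfolding Cr_on_def one_enat_def One_nat_def by blast
  then obtain D where "\<forall>x\<in>W. (f has_derivative D x) (at x within W)"
    by auto
  then show thesis
    using assms(4) at_within_openin_subset[OF assms(3,4)] that by metis
qed

text \<open>
  This is what the theory of differentials needs: transition maps with derivatives, and a closed model
  space in which these derivatives take their values.
\<close>

definition differentiable_manifold :: "('a, 'e::real_normed_vector) mfd \<Rightarrow> bool" where
  "differentiable_manifold M \<longleftrightarrow>
     subspace (Model M) \<and> closed (Model M) \<and>
     (\<forall>c\<in>Atlas M. is_chart (Top M) (Model M) c) \<and>
     (\<Union>c\<in>Atlas M. fst c) = Points M \<and>
     (\<forall>c\<in>Atlas M. \<forall>d\<in>Atlas M. \<forall>p\<in>fst c \<inter> fst d.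
        \<exists>L. (local_rep c d (\<lambda>p. p) has_derivative L) (at (snd c p) within Model M))"

lemma smooth_imp_differentiable_manifold:
  assumes "smooth_manifold M"
  shows "differentiable_manifold M"
proof -
  have chart: "is_chart (Top M) (Model M) c" if "c \<in> Atlas M" for c
    using assms that by (simp add: smooth_manifold_def)
  have "\<exists>L. (local_rep c d (\<lambda>p. p) has_derivative L) (at (snd c p) within Model M)"
    if cd: "c \<in> Atlas M" "d \<in> Atlas M" and p: "p \<in> fst c \<inter> fst d" for c d p
  proof -
    have Cr: "Cr_on (Model M) \<infinity> (snd c ` (fst c \<inter> fst d)) (local_rep c d (\<lambda>p. p))"
      using assms cd unfolding smooth_manifold_def by blast
    have W: "openin (top_of_set (Model M)) (snd c ` (fst c \<inter> fst d))"
      using chart_domain_open[OF chart[OF cd(1)]] chart_domain_open[OF chart[OF cd(2)]]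
      by (intro chart_image_open[OF chart[OF cd(1)]]) auto
    show ?thesis
      by (rule Cr_on_imp_has_derivative[OF Cr _ W imageI[OF p]]) auto
  qed
  then show ?thesis
    using assms chart subspace_finite_dim closed_finite_dim
    unfolding differentiable_manifold_def smooth_manifold_def by metis
qed

lemma differentiable_manifold_vector_mfd:
  fixes E :: "'e::real_normed_vector set"
  assumes "subspace E" "closed E"
  shows "differentiable_manifold (vector_mfd E)"
proof -
  let ?d = "(E, \<lambda>p. p) :: ('e, 'e) chart"
  have "(local_rep ?d ?d (\<lambda>p. p) has_derivative (\<lambda>v. v)) (at p within E)" if "p \<in> E" for p
  proof (rule has_derivative_transform[OF that])
    show "local_rep ?d ?d (\<lambda>p. p) x = x" if "x \<in> E" for x
      using local_rep_chart[OF is_chart_vector_mfd[of E], of x ?d "\<lambda>p. p"] that by simp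
  qed (rule has_derivative_ident)
  then show ?thesis
    using assms is_chart_vector_mfd unfolding differentiable_manifold_def by auto
qed

context
  fixes M :: "('a, 'e::real_normed_vector) mfd"
  assumes M: "differentiable_manifold M"
begin

lemma subspace_Model: "subspace (Model M)"
  and closed_Model: "closed (Model M)"
  and Atlas_is_chart: "c \<in> Atlas M \<Longrightarrow> is_chart (Top M) (Model M) c"
  using M by (auto simp: differentiable_manifold_def)

lemma charts_at_is_chart: "c \<in> charts_at M x \<Longrightarrow> is_chart (Top M) (Model M) c"
  and charts_at_domain: "c \<in> charts_at M x \<Longrightarrow> x \<in> fst c"
  using Atlas_is_chart by (auto simp: charts_at_def)

lemma charts_at_in_Model: "c \<in> charts_at M x \<Longrightarrow> snd c x \<in> Model M"
  using chart_image_in_model charts_at_is_chart charts_at_domain by metis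

lemma charts_at_nonempty: "x \<in> Points M \<Longrightarrow> charts_at M x \<noteq> {}"
  using M unfolding charts_at_def differentiable_manifold_def by blast

lemma rep_deriv_eq:
  assumes "c \<in> charts_at M x" "v \<in> Model M"
    and L: "(local_rep c d f has_derivative L) (at (snd c x) within Model M)"
  shows "rep_deriv M c d f x v = L v"
proof -
  have "(local_rep c d f has_derivative frechet_derivative (local_rep c d f)
      (at (snd c x) within Model M)) (at (snd c x) within Model M)"
    using L frechet_derivative_works differentiable_def by blast
  from has_derivative_unique_on_subspace[OF subspace_Model charts_at_in_Model[OF assms(1)]
      assms(2) this L]
  show ?thesis unfolding rep_deriv_def .
qed

end

text \<open>
  Unlike the definition of class C^r, this asks for derivatives in all pairs of charts, as the
  characterization of \<open>differential\<close> does. Continuity comes separately, since a chart representation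
  says nothing about points that leave the chart of the target.
\<close>

definition mfd_differentiable_at ::
  "('a, 'e::real_normed_vector) mfd \<Rightarrow> ('b, 'f::real_normed_vector) mfd \<Rightarrow> ('a \<Rightarrow> 'b) \<Rightarrow> 'a \<Rightarrow> bool"
where
  "mfd_differentiable_at M N f x \<longleftrightarrow>
     x \<in> Points M \<and> f x \<in> Points N \<and>
     (\<forall>Y. openin (Top N) Y \<longrightarrow> f x \<in> Y \<longrightarrow> (\<exists>T. openin (Top M) T \<and> x \<in> T \<and> f ` T \<subseteq> Y)) \<and>
     (\<forall>c\<in>charts_at M x. \<forall>d\<in>charts_at N (f x).
        \<exists>L. (local_rep c d f has_derivative L) (at (snd c x) within Model M))"

lemma mfd_differentiable_atD:
  assumes "mfd_differentiable_at M N f x"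
  shows "x \<in> Points M" "f x \<in> Points N"
  using assms by (auto simp: mfd_differentiable_at_def)

lemma mfd_differentiable_at_chartE:
  assumes "differentiable_manifold M" "differentiable_manifold N" "mfd_differentiable_at M N f x"
    and "c \<in> charts_at M x" "d \<in> charts_at N (f x)"
  obtains T where "openin (Top M) T" "x \<in> T" "T \<subseteq> fst c" "f ` T \<subseteq> fst d"
proof -
  have "openin (Top N) (fst d)" "f x \<in> fst d"
    by (rule chart_domain_open[OF charts_at_is_chart[OF assms(2,5)]])
      (rule charts_at_domain[OF assms(2,5)])
  then obtain T where "openin (Top M) T" "x \<in> T" "f ` T \<subseteq> fst d"
    using assms(3) unfolding mfd_differentiable_at_def by blast
  then show thesis
    using that[of "T \<inter> fst c"] charts_at_domain[OF assms(1,4)]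
      chart_domain_open[OF charts_at_is_chart[OF assms(1,4)]] by blast
qed

lemma has_derivative_rep_deriv:
  assumes "mfd_differentiable_at M N f x" "c \<in> charts_at M x" "d \<in> charts_at N (f x)"
  shows "(local_rep c d f has_derivative rep_deriv M c d f x) (at (snd c x) within Model M)"
  using assms unfolding mfd_differentiable_at_def rep_deriv_def
  by (metis differentiable_def frechet_derivative_works)

lemma rep_deriv_in_Model:
  assumes M: "differentiable_manifold M" and N: "differentiable_manifold N"
    and f: "mfd_differentiable_at M N f x"
    and c: "c \<in> charts_at M x" and d: "d \<in> charts_at N (f x)" and v: "v \<in> Model M"
  shows "rep_deriv M c d f x v \<in> Model N"
proof -
  obtain T where T: "openin (Top M) T" "x \<in> T" "T \<subseteq> fst c" "f ` T \<subseteq> fst d"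
    using mfd_differentiable_at_chartE[OF M N f c d] .
  note c' = charts_at_is_chart[OF M c] and d' = charts_at_is_chart[OF N d]
  have "local_rep c d f (snd c p) \<in> Model N" if "p \<in> T" for p
  proof -
    have "p \<in> fst c" "f p \<in> fst d" using that T(3,4) by auto
    then show ?thesis
      using local_rep_chart[OF c', of p d f] chart_image_in_model[OF d'] by simp
  qed
  then have "local_rep c d f ` (snd c ` T) \<subseteq> Model N" by auto
  then show ?thesis
    using derivative_in_closed_subspace[OF subspace_Model[OF M] chart_image_open[OF c' T(1,3)]
        imageI[OF T(2)] v has_derivative_rep_deriv[OF f c d]]
      subspace_Model[OF N] closed_Model[OF N] by blast
qed

lemma has_derivative_rep_deriv_compose:
  assumes M: "differentiable_manifold M" and N: "differentiable_manifold N"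
    and f: "mfd_differentiable_at M N f x" and g: "mfd_differentiable_at N P g (f x)"
    and h: "openin (Top M) S" "x \<in> S" "\<And>p. p \<in> S \<Longrightarrow> h p = g (f p)"
    and c: "c \<in> charts_at M x" and d: "d \<in> charts_at N (f x)" and e: "e \<in> charts_at P (h x)"
  shows "(local_rep c e h has_derivative
      (\<lambda>v. rep_deriv N d e g (f x) (rep_deriv M c d f x v))) (at (snd c x) within Model M)"
proof -
  obtain T where T: "openin (Top M) T" "x \<in> T" "T \<subseteq> fst c" "f ` T \<subseteq> fst d"
    using mfd_differentiable_at_chartE[OF M N f c d] .
  have e': "e \<in> charts_at P (g (f x))" using e h(2,3) by simp
  show ?thesis
  proof (rule has_derivative_local_rep_compose[OF charts_at_is_chart[OF M c]
        charts_at_is_chart[OF N d] _ _ _ _ _ has_derivative_rep_deriv[OF f c d]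
        has_derivative_rep_deriv[OF g d e']])
    show "openin (Top M) (T \<inter> S)" using T(1) h(1) by blast
    show "f ` (T \<inter> S) \<subseteq> fst d" using T(4) by blast
  qed (use T h in auto)
qed

lemma mfd_differentiable_at_ident:
  assumes M: "differentiable_manifold M" and x: "x \<in> Points M"
  shows "mfd_differentiable_at M M (\<lambda>p. p) x"
  using assms unfolding mfd_differentiable_at_def differentiable_manifold_def charts_at_def
  by auto

text \<open>
  A C^1 map has a derivative in one pair of charts at each point; composing with the derivatives of the
  transition maps on both sides gives derivatives in all the others.
\<close>

lemma mfd_Cr_on_imp_differentiable_at:
  assumes M: "differentiable_manifold M" and N: "differentiable_manifold N"
    and f: "mfd_Cr_on r M N S f" and r: "r \<ge> 1" and p: "p \<in> S"
  shows "mfd_differentiable_at M N f p"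
proof -
  have points: "p \<in> Points M" "f p \<in> Points N"
    using f p openin_subset unfolding mfd_Cr_on_def by blast+
  show ?thesis
    unfolding mfd_differentiable_at_def
  proof (intro conjI allI impI ballI points)
    fix Y assume Y: "openin (Top N) Y" "f p \<in> Y"
    show "\<exists>T. openin (Top M) T \<and> p \<in> T \<and> f ` T \<subseteq> Y"
      by (rule mfd_Cr_on_continuous[OF Atlas_is_chart[OF M] Atlas_is_chart[OF N] f p Y]) blast+
  next
    fix c d assume c: "c \<in> charts_at M p" and d: "d \<in> charts_at N (f p)"
    obtain c0 d0 T where c0: "c0 \<in> charts_at M p" and d0: "d0 \<in> charts_at N (f p)"
      and T: "openin (Top M) T" "p \<in> T" "T \<subseteq> S \<inter> fst c0" "f ` T \<subseteq> fst d0"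
      and Cr: "Cr_on (Model M) r (snd c0 ` T) (local_rep c0 d0 f)"
      using f p unfolding mfd_Cr_on_def by metis
    note charts = charts_at_is_chart[OF M c] charts_at_is_chart[OF M c0] charts_at_is_chart[OF N d0]
    have "openin (top_of_set (Model M)) (snd c0 ` T)"
      using chart_image_open[OF charts(2) T(1)] T(3) by blast
    then obtain L where L: "(local_rep c0 d0 f has_derivative L) (at (snd c0 p) within Model M)"
      using Cr_on_imp_has_derivative[OF Cr r _ imageI[OF T(2)]] by metis
    have ident: "mfd_differentiable_at M M (\<lambda>p. p) p" "mfd_differentiable_at N N (\<lambda>q. q) (f p)"
      by (rule mfd_differentiable_at_ident[OF M points(1)])
        (rule mfd_differentiable_at_ident[OF N points(2)])
    have "(local_rep c0 d f has_derivative (\<lambda>v. rep_deriv N d0 d (\<lambda>q. q) (f p) (L v)))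
        (at (snd c0 p) within Model M)"
      using T by (intro has_derivative_local_rep_compose[OF charts(2,3) T(1,2) _ T(4) _ L
          has_derivative_rep_deriv[OF ident(2) d0 d]]) auto
    then have "(local_rep c d f has_derivative
        (\<lambda>v. rep_deriv N d0 d (\<lambda>q. q) (f p) (L (rep_deriv M c c0 (\<lambda>p. p) p v))))
        (at (snd c p) within Model M)"
      using chart_domain_open[OF charts(1)] chart_domain_open[OF charts(2)] T(1)
        charts_at_domain[OF M c] charts_at_domain[OF M c0]
      by (intro has_derivative_local_rep_compose[OF charts(1,2), where T = "fst c \<inter> fst c0" and
            f = "\<lambda>p. p", OF _ _ _ _ _ has_derivative_rep_deriv[OF ident(1) c c0]]) auto
    then show "\<exists>L. (local_rep c d f has_derivative L) (at (snd c p) within Model M)"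
      by (intro exI)
  qed
qed

section \<open>The chain rule for differentials\<close>

lemma tangent_space_in_Model: "\<xi> \<in> tangent_space M x \<Longrightarrow> c \<in> charts_at M x \<Longrightarrow> \<xi> c \<in> Model M"
  unfolding tangent_space_def by (blast dest: PiE_mem)

lemma tangent_space_change:
  "\<xi> \<in> tangent_space M x \<Longrightarrow> c \<in> charts_at M x \<Longrightarrow> d \<in> charts_at M x \<Longrightarrow>
    \<xi> d = rep_deriv M c d (\<lambda>p. p) x (\<xi> c)"
  unfolding tangent_space_def by blast

lemma differential_eqI:
  assumes M: "differentiable_manifold M" and x: "x \<in> Points M"
    and \<eta>: "\<eta> \<in> tangent_space N (f x)"
    and coord: "\<And>c d. c \<in> charts_at M x \<Longrightarrow> d \<in> charts_at N (f x) \<Longrightarrow>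
      \<eta> d = rep_deriv M c d f x (\<xi> c)"
  shows "differential M N f x \<xi> = \<eta>"
  unfolding differential_def
proof (rule the_equality)
  fix \<zeta> assume \<zeta>: "\<zeta> \<in> tangent_space N (f x) \<and>
    (\<forall>c\<in>charts_at M x. \<forall>d\<in>charts_at N (f x). \<zeta> d = rep_deriv M c d f x (\<xi> c))"
  obtain c where "c \<in> charts_at M x" using charts_at_nonempty[OF M x] by blast
  then have "\<zeta> d = \<eta> d" if "d \<in> charts_at N (f x)" for d
    using \<zeta> coord that by metis
  then show "\<zeta> = \<eta>"
    using \<zeta> \<eta> unfolding tangent_space_def by (blast intro: PiE_ext)
qed (use \<eta> coord in blast)

text \<open>
  The vector with coordinates \<open>rep_deriv M c0 d f x (\<xi> c0)\<close>, for one fixed chart \<open>c0\<close>, witnesses the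
  definite description. The chain rule for \<open>f \<circ> id\<close> shows that \<open>c0\<close> may be replaced by any other chart,
  and the chain rule for \<open>id \<circ> f\<close> shows that the coordinates transform as those of a tangent vector.
\<close>

lemma differential_coordinates:
  assumes M: "differentiable_manifold M" and N: "differentiable_manifold N"
    and f: "mfd_differentiable_at M N f x" and \<xi>: "\<xi> \<in> tangent_space M x"
  shows "differential M N f x \<xi> \<in> tangent_space N (f x)"
    and "c \<in> charts_at M x \<Longrightarrow> d \<in> charts_at N (f x) \<Longrightarrow>
      differential M N f x \<xi> d = rep_deriv M c d f x (\<xi> c)"
proof -
  have x: "x \<in> Points M" "f x \<in> Points N"
    using f by (auto simp: mfd_differentiable_at_def)
  obtain c0 where c0: "c0 \<in> charts_at M x" using charts_at_nonempty[OF M x(1)] by blast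
  define \<eta> where "\<eta> = (\<lambda>d\<in>charts_at N (f x). rep_deriv M c0 d f x (\<xi> c0))"
  note whole_open = openin_topspace[of "Top M"]
  have coord: "\<eta> d = rep_deriv M c d f x (\<xi> c)"
    if c: "c \<in> charts_at M x" and d: "d \<in> charts_at N (f x)" for c d
  proof -
    have "rep_deriv M c d f x (\<xi> c) = rep_deriv M c0 d f x (rep_deriv M c c0 (\<lambda>p. p) x (\<xi> c))"
      using has_derivative_rep_deriv_compose[OF M M mfd_differentiable_at_ident[OF M x(1)] f whole_open x(1) refl
          c c0 d]
      by (rule rep_deriv_eq[OF M c tangent_space_in_Model[OF \<xi> c]])
    then show ?thesis
      using tangent_space_change[OF \<xi> c c0] d by (simp add: \<eta>_def)
  qed
  have "\<eta> \<in> tangent_space N (f x)"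
    unfolding tangent_space_def
  proof (intro CollectI conjI ballI PiE_I)
    fix d assume d: "d \<in> charts_at N (f x)"
    then show "\<eta> d \<in> Model N"
      using rep_deriv_in_Model[OF M N f c0 d tangent_space_in_Model[OF \<xi> c0]]
      by (simp add: \<eta>_def)
    fix d' assume d': "d' \<in> charts_at N (f x)"
    have "rep_deriv M c0 d' f x (\<xi> c0) =
        rep_deriv N d d' (\<lambda>p. p) (f x) (rep_deriv M c0 d f x (\<xi> c0))"
      using has_derivative_rep_deriv_compose[OF M N f mfd_differentiable_at_ident[OF N x(2)] whole_open x(1) refl
          c0 d d']
      by (rule rep_deriv_eq[OF M c0 tangent_space_in_Model[OF \<xi> c0]])
    then show "\<eta> d' = rep_deriv N d d' (\<lambda>p. p) (f x) (\<eta> d)"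
      using d d' by (simp add: \<eta>_def)
  qed (simp add: \<eta>_def)
  moreover from this coord have "differential M N f x \<xi> = \<eta>"
    by (rule differential_eqI[OF M x(1)])
  ultimately show "differential M N f x \<xi> \<in> tangent_space N (f x)"
    and "c \<in> charts_at M x \<Longrightarrow> d \<in> charts_at N (f x) \<Longrightarrow>
      differential M N f x \<xi> d = rep_deriv M c d f x (\<xi> c)"
    using coord by auto
qed

lemma differential_compose:
  assumes M: "differentiable_manifold M" and N: "differentiable_manifold N"
    and P: "differentiable_manifold P"
    and f: "mfd_differentiable_at M N f x" and g: "mfd_differentiable_at N P g (f x)"
    and h: "openin (Top M) S" "x \<in> S" "\<And>p. p \<in> S \<Longrightarrow> h p = g (f p)"
    and \<xi>: "\<xi> \<in> tangent_space M x"
  shows "differential M P h x \<xi> = differential N P g (f x) (differential M N f x \<xi>)"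
proof (rule differential_eqI[OF M])
  note df = differential_coordinates[OF M N f \<xi>]
  note dg = differential_coordinates[OF N P g df(1)]
  show "x \<in> Points M" using f by (simp add: mfd_differentiable_at_def)
  show "differential N P g (f x) (differential M N f x \<xi>) \<in> tangent_space P (h x)"
    using dg(1) h(2,3) by simp
  fix c e assume c: "c \<in> charts_at M x" and e: "e \<in> charts_at P (h x)"
  obtain d where d: "d \<in> charts_at N (f x)"
    using charts_at_nonempty[OF N mfd_differentiable_atD(2)[OF f]] by blast
  have "rep_deriv M c e h x (\<xi> c) = rep_deriv N d e g (f x) (rep_deriv M c d f x (\<xi> c))"
    using has_derivative_rep_deriv_compose[OF M N f g h c d e]
    by (rule rep_deriv_eq[OF M c tangent_space_in_Model[OF \<xi> c]])
  then show "differential N P g (f x) (differential M N f x \<xi>) e = rep_deriv M c e h x (\<xi> c)"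
    using df(2)[OF c d] dg(2)[OF d, of e] e h(2,3) by simp
qed

lemma to_tangent_from_tangent:
  assumes "y \<in> E" "\<eta> \<in> tangent_space (vector_mfd E) y"
  shows "to_tangent E (from_tangent E \<eta>) = \<eta>"
proof (rule extensionalityI[where A = "{(E, \<lambda>p. p)}"])
  show "\<eta> \<in> extensional {(E, \<lambda>p. p)}"
    using assms(2) unfolding tangent_space_def charts_at_vector_mfd[OF assms(1)] PiE_def by blast
qed (simp_all add: to_tangent_def from_tangent_def)

section \<open>The parameter spaces of barcodes\<close>

lemma coordinate_frame_Times:
  fixes F :: "'f::real_normed_vector set" and G :: "'g::real_normed_vector set"
  assumes F: "coordinate_frame F I \<phi> e" and G: "coordinate_frame G J \<psi> e'"
    and zero: "0 \<in> F" "0 \<in> G"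
  shows "coordinate_frame (F \<times> G) (I <+> J)
    (case_sum (\<lambda>i w. \<phi> i (fst w)) (\<lambda>j w. \<psi> j (snd w)))
    (case_sum (\<lambda>i. (e i, 0)) (\<lambda>j. (0, e' j)))"
  unfolding coordinate_frame_def
proof (intro conjI ballI)
  have "finite I" "finite J"
    using F G by (simp_all add: coordinate_frame_def)
  then show "finite (I <+> J)"
    by (rule finite_Plus)
  fix k assume k: "k \<in> I <+> J"
  show "bounded_linear (case_sum (\<lambda>i w. \<phi> i (fst w)) (\<lambda>j w. \<psi> j (snd w)) k)"
  proof (cases k)
    case (Inl i)
    then have "bounded_linear (\<phi> i)"
      using k F by (auto simp: coordinate_frame_def)
    then show ?thesis
      using Inl bounded_linear_compose[OF _ bounded_linear_fst] by simp
  next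
    case (Inr j)
    then have "bounded_linear (\<psi> j)"
      using k G by (auto simp: coordinate_frame_def)
    then show ?thesis
      using Inr bounded_linear_compose[OF _ bounded_linear_snd] by simp
  qed
  show "case_sum (\<lambda>i. (e i, 0)) (\<lambda>j. (0, e' j)) k \<in> F \<times> G"
    using k F G zero unfolding coordinate_frame_def by (cases k) auto
next
  have fin: "finite I" "finite J"
    using F G by (simp_all add: coordinate_frame_def)
  fix w assume w: "w \<in> F \<times> G"
  have "fst w = (\<Sum>i\<in>I. \<phi> i (fst w) *\<^sub>R e i)" "snd w = (\<Sum>j\<in>J. \<psi> j (snd w) *\<^sub>R e' j)"
    using F G w unfolding coordinate_frame_def by auto
  then show "w = (\<Sum>k\<in>I <+> J. case_sum (\<lambda>i w. \<phi> i (fst w)) (\<lambda>j w. \<psi> j (snd w)) k w *\<^sub>R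
      case_sum (\<lambda>i. (e i, 0)) (\<lambda>j. (0, e' j)) k)"
    using fin by (simp add: sum.Plus prod_eq_iff fst_sum snd_sum)
qed

lemma bounded_linear_apply_bcontfun: "bounded_linear (\<lambda>x::rseq. apply_bcontfun x i)"
proof (rule bounded_linear_intro[where K = 1])
  show "norm (apply_bcontfun x i) \<le> norm x * 1" for x :: rseq
    using norm_bounded[of x i] by simp
qed simp_all

definition unit_seq :: "nat \<Rightarrow> rseq" where
  "unit_seq i = Bcontfun (\<lambda>j. if j = i then 1 else 0)"

lemma apply_unit_seq: "apply_bcontfun (unit_seq i) j = (if j = i then 1 else 0)"
proof -
  have "(\<lambda>j. if j = i then 1 else 0 :: real) \<in> bcontfun"
    by (rule bcontfun_normI[where b = 1]) auto
  then show ?thesis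
    by (simp add: unit_seq_def Bcontfun_inverse)
qed

lemma subspace_Rn: "subspace (Rn n)"
  by (auto simp: subspace_def Rn_def)

lemma closed_Rn: "closed (Rn n)"
proof -
  have "Rn n = (\<Inter>i\<in>{n..}. {x. apply_bcontfun x i = 0})"
    by (auto simp: Rn_def)
  moreover have "closed {x::rseq. apply_bcontfun x i = 0}" for i
    by (intro closed_Collect_eq continuous_on_const
        bounded_linear.continuous_on[OF bounded_linear_apply_bcontfun] continuous_on_id)
  ultimately show ?thesis by (metis closed_INT)
qed

lemma coordinate_frame_Rn:
  "coordinate_frame (Rn n) {..<n} (\<lambda>i x. apply_bcontfun x i) unit_seq"
  unfolding coordinate_frame_def
proof (intro conjI ballI bounded_linear_apply_bcontfun finite_lessThan)
  show "unit_seq i \<in> Rn n" if "i \<in> {..<n}" for i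
    using that by (auto simp: Rn_def apply_unit_seq)
  fix x assume x: "x \<in> Rn n"
  show "x = (\<Sum>i\<in>{..<n}. apply_bcontfun x i *\<^sub>R unit_seq i)"
  proof (rule bcontfun_eqI)
    fix j
    have "apply_bcontfun (\<Sum>i\<in>{..<n}. apply_bcontfun x i *\<^sub>R unit_seq i) j =
        (\<Sum>i\<in>{..<n}. apply_bcontfun (apply_bcontfun x i *\<^sub>R unit_seq i) j)"
      by (rule linear_sum[OF bounded_linear.linear[OF bounded_linear_apply_bcontfun]])
    also have "\<dots> = (\<Sum>i\<in>{..<n}. if j = i then apply_bcontfun x i else 0)"
      by (intro sum.cong) (auto simp: apply_unit_seq)
    also have "\<dots> = apply_bcontfun x j"
      using x by (auto simp: Rn_def)
    finally show "apply_bcontfun x j =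
        apply_bcontfun (\<Sum>i\<in>{..<n}. apply_bcontfun x i *\<^sub>R unit_seq i) j" by (rule sym)
  qed
qed

lemma subspace_param_space: "subspace (param_space m n)"
  and closed_param_space: "closed (param_space m n)"
  by (simp_all add: param_space_def subspace_Times subspace_Rn closed_Times closed_Rn)

lemma coordinate_frame_param_space:
  obtains \<phi> e where "coordinate_frame (param_space m n) ({..<2 * m} <+> {..<n}) \<phi> e"
  using coordinate_frame_Times[OF coordinate_frame_Rn coordinate_frame_Rn
      subspace_0[OF subspace_Rn] subspace_0[OF subspace_Rn], of "2 * m" n]
  unfolding param_space_def by blast

section \<open>Composition through barcodes\<close>

text \<open>
  A lift of \<open>B\<close> replaces the passage through the set of barcodes, which carries no manifold structure,
  by a passage through a parameter space.
\<close>

lemma local_lift_factorization: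
  assumes "local_lift k M B x U m n B'" "differentiable_from_Bar r N V (B x)"
  shows "mfd_Cr_on k M (param_mfd m n) U B'" "openin (Top M) U" "x \<in> U"
    and "B' x \<in> param_space m n"
    and "\<And>p. p \<in> U \<Longrightarrow> (V \<circ> B) p = (V \<circ> Q m n) (B' p)"
    and "mfd_Cr_at r (param_mfd m n) N (V \<circ> Q m n) (B' x)"
proof -
  show B': "mfd_Cr_on k M (param_mfd m n) U B'" and "openin (Top M) U" and x: "x \<in> U"
    using assms(1) by (auto simp: local_lift_def)
  show B'x: "B' x \<in> param_space m n"
    using B' x by (auto simp: mfd_Cr_on_def)
  show "\<And>p. p \<in> U \<Longrightarrow> (V \<circ> B) p = (V \<circ> Q m n) (B' p)"
    using assms(1) by (auto simp: local_lift_def)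
  have "Q m n (B' x) = B x"
    using assms(1) x by (auto simp: local_lift_def)
  then show "mfd_Cr_at r (param_mfd m n) N (V \<circ> Q m n) (B' x)"
    using assms(2) B'x unfolding differentiable_from_Bar_def by blast
qed

theorem proposition3p14:
  fixes M :: "('a, 'e::real_normed_vector) mfd"
    and N :: "('b, 'f::real_normed_vector) mfd"
    and r :: enat
    and B :: "'a \<Rightarrow> barcode"
    and V :: "barcode \<Rightarrow> 'b"
    and x :: 'a
  assumes "smooth_manifold M" and "smooth_manifold N"
    and "B \<in> Points M \<rightarrow> Bar" and "V \<in> Bar \<rightarrow> Points N"
    and "x \<in> Points M"
    and "differentiable_to_Bar r M B x"
    and "differentiable_from_Bar r N V (B x)"
  shows "mfd_Cr_at r M N (V \<circ> B) x \<and>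
    (r \<ge> 1 \<longrightarrow>
      (\<forall>U m n B'. local_lift 1 M B x U m n B' \<longrightarrow>
        (\<forall>\<xi>\<in>tangent_space M x.
           differential M N (V \<circ> B) x \<xi> =
             (differential_from_Bar N V m n (B' x) \<circ> differential_to_Bar M m n B' x) \<xi>)))"
proof (intro conjI impI allI ballI)
  note M = smooth_imp_differentiable_manifold[OF assms(1)]
  note N = smooth_imp_differentiable_manifold[OF assms(2)]
  show "mfd_Cr_at r M N (V \<circ> B) x"
  proof -
    obtain U m n B' where "local_lift r M B x U m n B'"
      using assms(6) unfolding differentiable_to_Bar_def by metis
    note lift = local_lift_factorization[OF this assms(7)]
    obtain S where S: "B' x \<in> S" "mfd_Cr_on r (param_mfd m n) N S (V \<circ> Q m n)"
      using lift(6) unfolding mfd_Cr_at_def by metis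
    obtain \<phi> e where frame: "coordinate_frame (param_space m n) ({..<2 * m} <+> {..<n}) \<phi> e"
      by (rule coordinate_frame_param_space)
    show ?thesis
      by (rule mfd_Cr_compose_through_vector_space[OF Atlas_is_chart[OF M] subspace_Model[OF M]
            subspace_param_space closed_param_space frame lift(1) S(2) lift(5,3) S(1)])
  qed
  fix U m n B' \<xi>
  assume r: "r \<ge> 1" and "local_lift 1 M B x U m n B'" and \<xi>: "\<xi> \<in> tangent_space M x"
  note lift = local_lift_factorization[OF this(2) assms(7)]
  obtain S where S: "B' x \<in> S" "mfd_Cr_on r (param_mfd m n) N S (V \<circ> Q m n)"
    using lift(6) unfolding mfd_Cr_at_def by metis
  \<comment> \<open>The lift is only C^1, possibly less regular than the one in the first part, with other \<open>m\<close> and \<open>n\<close>;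
    \<open>V\<close> composed with the quotient map is differentiable at \<open>B' x\<close> because \<open>V\<close> is differentiable
    with respect to every preimage of \<open>B x\<close>.\<close>
  note P = differentiable_manifold_vector_mfd[OF subspace_param_space[of m n] closed_param_space]
  have f: "mfd_differentiable_at M (param_mfd m n) B' x"
    by (rule mfd_Cr_on_imp_differentiable_at[OF M P lift(1) order_refl lift(3)])
  have g: "mfd_differentiable_at (param_mfd m n) N (V \<circ> Q m n) (B' x)"
    by (rule mfd_Cr_on_imp_differentiable_at[OF P N S(2) r S(1)])
  have "differential M N (V \<circ> B) x \<xi> =
      differential (param_mfd m n) N (V \<circ> Q m n) (B' x) (differential M (param_mfd m n) B' x \<xi>)"
    by (rule differential_compose[OF M P N f g lift(2,3,5) \<xi>])
  also have "\<dots> = (differential_from_Bar N V m n (B' x) \<circ> differential_to_Bar M m n B' x) \<xi>"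
    using to_tangent_from_tangent[OF lift(4) differential_coordinates(1)[OF M P f \<xi>]]
    by (simp add: differential_from_Bar_def differential_to_Bar_def)
  finally show "differential M N (V \<circ> B) x \<xi> =
      (differential_from_Bar N V m n (B' x) \<circ> differential_to_Bar M m n B' x) \<xi>" .
qed

end
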